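(* Let $\alpha$ be an $E_0$-semigroup on a $\mathrm{II}_1$ factor $\mathrm{M}$ acting standardly on $L^2(\mathrm{M})$, with complementary $E_0$-semigroup $\alpha'$ on $\mathrm{M}'$. If there exists an $E_0$-semigroup $\sigma$ on $B(L^2(\mathrm{M}))$ such that for all $t\ge 0$ $$\sigma_t(x)=\alpha_t(x)\ \text{ for all } x\in\mathrm{M},\qquad \sigma_t(x)=\alpha'_t(x)\ \text{ for all } x\in\mathrm{M}',$$ then the coupling index $\mathrm{Ind}_c(\alpha)$ is equal to the Powers–Arveson index of $\sigma$.
   Context: An $E_0$-semigroup on a von Neumann algebra $\mathrm{M}$ is a semigroup $(\alpha_t)_{t\ge 0}$ of normal unital $*$-endomorphisms of $\mathrm{M}$ with $\alpha_0=\mathrm{id}$, $\alpha_t(\mathrm{M})\ne \mathrm{M}$ for all $t>0$, and $t\mapsto\rho(\alpha_t(x))$ continuous for all $x\in\mathrm{M}$, $\rho\in\mathrm{M}_*$. A $\mathrm{II}_1$ factor $\mathrm{M}$ with trace $\tau$ acts standardly on $H=L^2(\mathrm{M})$ with cyclic and separating trace vector $\Omega$ and modular conjugation $J$. The complementary $E_0$-semigroup of $\alpha$ is $\alpha'_t(x')=J\alpha_t(Jx'J)J$ on $\mathrm{M}'$. A multi-unit for $\alpha$ is a strongly continuous semigroup $(T_t)_{t\ge0}$ of bounded operators on $H$ with $T_0=1$, $T_tx=\alpha_t(x)T_t$ for all $x\in \mathrm{M}$ and $T_tx'=\alpha_t'(x')T_t$ for all $x'\in\mathrm{M}'$. Let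 $\mathcal{U}_{\alpha,\alpha'}$ be the set of multi-units (it is non-empty). For $X,Y\in\mathcal{U}_{\alpha,\alpha'}$ there is a unique $c(X,Y)\in\mathbb{C}$ with $X_t^*Y_t=e^{c(X,Y)t}1$ for all $t\ge0$. The form $\langle f,g\rangle=\sum_{X,Y}c(X,Y)\overline{f(X)}g(Y)$ is positive semidefinite on the space of finitely supported functions $f:\mathcal{U}_{\alpha,\alpha'}\to\mathbb{C}$ with $\sum_X f(X)=0$; let $H(\mathcal{U}_{\alpha,\alpha'})$ be the Hilbert space obtained by quotienting by null vectors and completing. The coupling index is $\mathrm{Ind}_c(\alpha)=\dim H(\mathcal{U}_{\alpha,\alpha'})$. The Powers–Arveson index of an $E_0$-semigroup $\sigma$ on $B(H)$ having units is defined as follows. A unit for $\sigma$ is a strongly continuous semigroup $(T_t)_{t\ge0}$ in $B(H)$ with $T_0=1$ and $T_tx=\sigma_t(x)T_t$ for all $x\in B(H)$. Let $\mathcal{U}_\sigma$ be the set of units for $\sigma$. For $X,Y\in\mathcal{U}_\sigma$ there is a unique $c(X,Y)\in\mathbb{C}$ with $X_t^*Y_t=e^{c(X,Y)t}1$ for all $t\ge0$. The form $\langle f,g\rangle=\sum_{X,Y\in\mathcal{U}_\sigma}c(X,Y)\overline{f(X)}g(Y)$ is positive semidefinite on the space of finitely supported functions $f:\mathcal{U}_\sigma\to\mathbb{C}$ with $\sum_{X\in\mathcal{U}_\sigma} f(X)=0$, and the index is the dimension of the Hilbert space obtained from this space by quotienting by the null vectors of the form and completing. *)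

theory Defs
  imports "HOL-Analysis.Analysis"
begin

unbundle cardinal_syntax

section \<open>Complex Hilbert spaces and their bounded operators\<close>

text \<open>The inner product is linear in its second argument. Definiteness follows from the
  last axiom, completeness from \<^class>\<open>banach\<close>.\<close>

class complex_hilbert = banach +
  fixes scaleC :: "complex \<Rightarrow> 'a \<Rightarrow> 'a" (infixr "*\<^sub>C" 75)
    and cinner :: "'a \<Rightarrow> 'a \<Rightarrow> complex"
  assumes scaleC_add_right: "c *\<^sub>C (x + y) = c *\<^sub>C x + c *\<^sub>C y"
    and scaleC_add_left: "(c + d) *\<^sub>C x = c *\<^sub>C x + d *\<^sub>C x"
    and scaleC_scaleC: "c *\<^sub>C (d *\<^sub>C x) = (c * d) *\<^sub>C x"
    and scaleC_of_real: "complex_of_real r *\<^sub>C x = r *\<^sub>R x"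
    and cinner_commute: "cinner x y = cnj (cinner y x)"
    and cinner_add_right: "cinner x (y + z) = cinner x y + cinner x z"
    and cinner_scaleC_right: "cinner x (c *\<^sub>C y) = c * cinner x y"
    and cinner_self: "cinner x x = complex_of_real ((norm x)\<^sup>2)"

text \<open>The type \<open>'h \<Rightarrow>\<^sub>L 'h\<close> consists of the bounded \<^emph>\<open>real\<close>-linear maps. It contains
  both \<open>B(H)\<close>, which is the following subset, and conjugate-linear maps such as the modular
  conjugation.\<close>

definition bounded_ops :: "('h::complex_hilbert \<Rightarrow>\<^sub>L 'h) set" where
  "bounded_ops = {A :: 'h \<Rightarrow>\<^sub>L 'h. \<forall>c v. A (c *\<^sub>C v) = c *\<^sub>C A v}"

definition scalar_op :: "complex \<Rightarrow> 'h::complex_hilbert \<Rightarrow>\<^sub>L 'h" where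
  "scalar_op c = Blinfun (\<lambda>v. c *\<^sub>C v)"

lemma norm_scaleC: "norm (c *\<^sub>C (x::'h::complex_hilbert)) = cmod c * norm x"
proof -
  have "cinner (c *\<^sub>C x) (c *\<^sub>C x) = c * cnj (c * cinner x x)"
    by (metis cinner_commute cinner_scaleC_right)
  also have "\<dots> = complex_of_real ((cmod c * norm x)\<^sup>2)"
    by (simp add: cinner_self power_mult_distrib)
       (metis complex_norm_square of_real_power)
  finally have "(norm (c *\<^sub>C x))\<^sup>2 = (cmod c * norm x)\<^sup>2"
    by (metis cinner_self of_real_eq_iff)
  then show ?thesis
    by (simp add: power2_eq_iff_nonneg)
qed

lemma scalar_op_apply [simp]: "scalar_op c v = c *\<^sub>C v"
proof -
  have "bounded_linear (\<lambda>v::'a. c *\<^sub>C v)"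
  proof (rule bounded_linear_intro[where K = "cmod c"])
    fix r :: real and x :: 'a
    show "c *\<^sub>C (r *\<^sub>R x) = r *\<^sub>R (c *\<^sub>C x)"
      by (metis scaleC_of_real scaleC_scaleC mult.commute)
  qed (simp_all add: scaleC_add_right norm_scaleC mult.commute)
  then show ?thesis
    by (simp add: scalar_op_def bounded_linear_Blinfun_apply)
qed

definition adj_op :: "('h::complex_hilbert \<Rightarrow>\<^sub>L 'h) \<Rightarrow> ('h \<Rightarrow>\<^sub>L 'h)" where
  "adj_op A = (THE B :: 'h \<Rightarrow>\<^sub>L 'h. \<forall>u v. cinner (B u) v = cinner u (A v))"


section \<open>Von Neumann algebras\<close>

definition commutant :: "('h::complex_hilbert \<Rightarrow>\<^sub>L 'h) set \<Rightarrow> ('h \<Rightarrow>\<^sub>L 'h) set" where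
  "commutant S = {A \<in> bounded_ops. \<forall>B\<in>S. A o\<^sub>L B = B o\<^sub>L A}"

definition von_neumann_algebra :: "('h::complex_hilbert \<Rightarrow>\<^sub>L 'h) set \<Rightarrow> bool" where
  "von_neumann_algebra M \<longleftrightarrow>
     M \<subseteq> bounded_ops \<and> (\<forall>x\<in>M. adj_op x \<in> M) \<and> commutant (commutant M) = M"

definition vn_factor :: "('h::complex_hilbert \<Rightarrow>\<^sub>L 'h) set \<Rightarrow> bool" where
  "vn_factor M \<longleftrightarrow>
     von_neumann_algebra M \<and> M \<inter> commutant M = range scalar_op \<and> id_blinfun \<noteq> (0 :: 'h \<Rightarrow>\<^sub>L 'h)"

definition projections :: "('h::complex_hilbert \<Rightarrow>\<^sub>L 'h) set \<Rightarrow> ('h \<Rightarrow>\<^sub>L 'h) set" where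
  "projections M = {p \<in> M. p o\<^sub>L p = p \<and> adj_op p = p}"

definition mvn_equiv ::
  "('h::complex_hilbert \<Rightarrow>\<^sub>L 'h) set \<Rightarrow> ('h \<Rightarrow>\<^sub>L 'h) \<Rightarrow> ('h \<Rightarrow>\<^sub>L 'h) \<Rightarrow> bool" where
  "mvn_equiv M p q \<longleftrightarrow> (\<exists>v\<in>M. adj_op v o\<^sub>L v = p \<and> v o\<^sub>L adj_op v = q)"

definition finite_projection ::
  "('h::complex_hilbert \<Rightarrow>\<^sub>L 'h) set \<Rightarrow> ('h \<Rightarrow>\<^sub>L 'h) \<Rightarrow> bool" where
  "finite_projection M p \<longleftrightarrow>
     p \<in> projections M \<and> (\<forall>q\<in>projections M. p o\<^sub>L q = q \<and> mvn_equiv M p q \<longrightarrow> q = p)"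

definition abelian_projection ::
  "('h::complex_hilbert \<Rightarrow>\<^sub>L 'h) set \<Rightarrow> ('h \<Rightarrow>\<^sub>L 'h) \<Rightarrow> bool" where
  "abelian_projection M p \<longleftrightarrow>
     p \<in> projections M \<and>
     (\<forall>x\<in>M. \<forall>y\<in>M. (p o\<^sub>L x o\<^sub>L p) o\<^sub>L (p o\<^sub>L y o\<^sub>L p) = (p o\<^sub>L y o\<^sub>L p) o\<^sub>L (p o\<^sub>L x o\<^sub>L p))"

definition II1_factor :: "('h::complex_hilbert \<Rightarrow>\<^sub>L 'h) set \<Rightarrow> bool" where
  "II1_factor M \<longleftrightarrow>
     vn_factor M \<and> finite_projection M id_blinfun \<and> (\<forall>p. abelian_projection M p \<longrightarrow> p = 0)"

text \<open>\<open>\<Omega>\<close> is a cyclic and separating unit vector whose vector state is the trace of \<open>M\<close>. Up to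
  unitary equivalence this says that the Hilbert space is \<open>L\<^sup>2(M)\<close> and \<open>\<Omega>\<close> is the class
  of \<open>1\<close>.\<close>

definition standard_trace_vector ::
  "('h::complex_hilbert \<Rightarrow>\<^sub>L 'h) set \<Rightarrow> 'h \<Rightarrow> bool" where
  "standard_trace_vector M \<Omega> \<longleftrightarrow>
     norm \<Omega> = 1 \<and>
     (\<forall>x\<in>M. \<forall>y\<in>M. cinner \<Omega> ((x o\<^sub>L y) \<Omega>) = cinner \<Omega> ((y o\<^sub>L x) \<Omega>)) \<and>
     closure ((\<lambda>x. blinfun_apply x \<Omega>) ` M) = UNIV \<and>
     (\<forall>x\<in>M. blinfun_apply x \<Omega> = 0 \<longrightarrow> x = 0)"

text \<open>For a cyclic trace vector, \<open>x \<Omega> \<mapsto> x\<^sup>* \<Omega>\<close> is isometric with dense domain, so it has a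
  unique bounded extension; its modular operator is trivial and the extension is the modular
  conjugation.\<close>

definition modular_conj :: "('h::complex_hilbert \<Rightarrow>\<^sub>L 'h) set \<Rightarrow> 'h \<Rightarrow> ('h \<Rightarrow>\<^sub>L 'h)" where
  "modular_conj M \<Omega> = (THE J :: 'h \<Rightarrow>\<^sub>L 'h. \<forall>x\<in>M. J (blinfun_apply x \<Omega>) = adj_op x \<Omega>)"

text \<open>\<open>M\<^sub>*\<close> consists of the functionals \<open>x \<mapsto> \<Sum>n. \<langle>\<xi>\<^sub>n, x \<eta>\<^sub>n\<rangle>\<close> on \<open>M\<close> with
  \<open>\<Sum>n. \<parallel>\<xi>\<^sub>n\<parallel>\<^sup>2\<close> and \<open>\<Sum>n. \<parallel>\<eta>\<^sub>n\<parallel>\<^sup>2\<close> finite. A member of the set below is an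
  arbitrary extension of such a functional to the ambient type; its values outside \<open>M\<close> are
  never used.\<close>

definition predual ::
  "('h::complex_hilbert \<Rightarrow>\<^sub>L 'h) set \<Rightarrow> (('h \<Rightarrow>\<^sub>L 'h) \<Rightarrow> complex) set" where
  "predual M = {\<rho>. \<exists>\<xi> \<eta> :: nat \<Rightarrow> 'h.
     summable (\<lambda>n. (norm (\<xi> n))\<^sup>2) \<and> summable (\<lambda>n. (norm (\<eta> n))\<^sup>2) \<and>
     (\<forall>x\<in>M. \<rho> x = (\<Sum>n. cinner (\<xi> n) (blinfun_apply x (\<eta> n))))}"

definition ultraweak_topology ::
  "('h::complex_hilbert \<Rightarrow>\<^sub>L 'h) set \<Rightarrow> ('h \<Rightarrow>\<^sub>L 'h) topology" where
  "ultraweak_topology M =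
     topology_generated_by {{x \<in> M. \<rho> x \<in> W} |\<rho> W. \<rho> \<in> predual M \<and> open W}"

definition normal_unital_star_endo ::
  "('h::complex_hilbert \<Rightarrow>\<^sub>L 'h) set \<Rightarrow> (('h \<Rightarrow>\<^sub>L 'h) \<Rightarrow> ('h \<Rightarrow>\<^sub>L 'h)) \<Rightarrow> bool" where
  "normal_unital_star_endo M \<phi> \<longleftrightarrow>
     (\<forall>x\<in>M. \<phi> x \<in> M) \<and>
     (\<forall>x\<in>M. \<forall>y\<in>M. \<phi> (x + y) = \<phi> x + \<phi> y) \<and>
     (\<forall>c. \<forall>x\<in>M. \<phi> (scalar_op c o\<^sub>L x) = scalar_op c o\<^sub>L \<phi> x) \<and>
     (\<forall>x\<in>M. \<forall>y\<in>M. \<phi> (x o\<^sub>L y) = \<phi> x o\<^sub>L \<phi> y) \<and>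
     (\<forall>x\<in>M. \<phi> (adj_op x) = adj_op (\<phi> x)) \<and>
     \<phi> id_blinfun = id_blinfun \<and>
     continuous_map (ultraweak_topology M) (ultraweak_topology M) \<phi>"


section \<open>\<open>E\<^sub>0\<close>-semigroups, units and multi-units\<close>

text \<open>Only the values \<open>\<alpha> t x\<close> with \<open>t \<ge> 0\<close> and \<open>x \<in> M\<close> matter.\<close>

definition E0_semigroup ::
  "('h::complex_hilbert \<Rightarrow>\<^sub>L 'h) set \<Rightarrow> (real \<Rightarrow> ('h \<Rightarrow>\<^sub>L 'h) \<Rightarrow> ('h \<Rightarrow>\<^sub>L 'h)) \<Rightarrow> bool" where
  "E0_semigroup M \<alpha> \<longleftrightarrow>
     (\<forall>t\<ge>0. normal_unital_star_endo M (\<alpha> t)) \<and>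
     (\<forall>x\<in>M. \<alpha> 0 x = x) \<and>
     (\<forall>s\<ge>0. \<forall>t\<ge>0. \<forall>x\<in>M. \<alpha> (s + t) x = \<alpha> s (\<alpha> t x)) \<and>
     (\<forall>t>0. \<alpha> t ` M \<noteq> M) \<and>
     (\<forall>x\<in>M. \<forall>\<rho>\<in>predual M. continuous_on {0..} (\<lambda>t. \<rho> (\<alpha> t x)))"

definition complementary ::
  "('h::complex_hilbert \<Rightarrow>\<^sub>L 'h) set \<Rightarrow> 'h \<Rightarrow> (real \<Rightarrow> ('h \<Rightarrow>\<^sub>L 'h) \<Rightarrow> ('h \<Rightarrow>\<^sub>L 'h))
     \<Rightarrow> real \<Rightarrow> ('h \<Rightarrow>\<^sub>L 'h) \<Rightarrow> ('h \<Rightarrow>\<^sub>L 'h)" where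
  "complementary M \<Omega> \<alpha> t x' =
     (let J = modular_conj M \<Omega> in J o\<^sub>L \<alpha> t (J o\<^sub>L x' o\<^sub>L J) o\<^sub>L J)"

text \<open>Extensionality makes each family \<open>(T\<^sub>t)\<^bsub>t \<ge> 0\<^esub>\<close> correspond to exactly one
  function on the reals.\<close>

definition operator_semigroup :: "(real \<Rightarrow> ('h::complex_hilbert \<Rightarrow>\<^sub>L 'h)) \<Rightarrow> bool" where
  "operator_semigroup T \<longleftrightarrow>
     T \<in> extensional {0..} \<and>
     (\<forall>t\<ge>0. T t \<in> bounded_ops) \<and>
     T 0 = id_blinfun \<and>
     (\<forall>s\<ge>0. \<forall>t\<ge>0. T (s + t) = T s o\<^sub>L T t) \<and>
     (\<forall>v. continuous_on {0..} (\<lambda>t. T t v))"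

definition multi_units ::
  "('h::complex_hilbert \<Rightarrow>\<^sub>L 'h) set \<Rightarrow> 'h \<Rightarrow> (real \<Rightarrow> ('h \<Rightarrow>\<^sub>L 'h) \<Rightarrow> ('h \<Rightarrow>\<^sub>L 'h))
     \<Rightarrow> (real \<Rightarrow> ('h \<Rightarrow>\<^sub>L 'h)) set" where
  "multi_units M \<Omega> \<alpha> = {T. operator_semigroup T \<and>
     (\<forall>t\<ge>0. \<forall>x\<in>M. T t o\<^sub>L x = \<alpha> t x o\<^sub>L T t) \<and>
     (\<forall>t\<ge>0. \<forall>x'\<in>commutant M. T t o\<^sub>L x' = complementary M \<Omega> \<alpha> t x' o\<^sub>L T t)}"

definition units ::
  "(real \<Rightarrow> ('h::complex_hilbert \<Rightarrow>\<^sub>L 'h) \<Rightarrow> ('h \<Rightarrow>\<^sub>L 'h)) \<Rightarrow> (real \<Rightarrow> ('h \<Rightarrow>\<^sub>L 'h)) set" where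
  "units \<sigma> = {T. operator_semigroup T \<and>
     (\<forall>t\<ge>0. \<forall>x\<in>bounded_ops. T t o\<^sub>L x = \<sigma> t x o\<^sub>L T t)}"

definition covariance ::
  "(real \<Rightarrow> ('h::complex_hilbert \<Rightarrow>\<^sub>L 'h)) \<Rightarrow> (real \<Rightarrow> ('h \<Rightarrow>\<^sub>L 'h)) \<Rightarrow> complex" where
  "covariance X Y =
     (THE c. \<forall>t\<ge>0. adj_op (X t) o\<^sub>L Y t = scalar_op (exp (c * complex_of_real t)))"


section \<open>The Hilbert space of a conditionally positive semidefinite kernel\<close>

text \<open>Functions on \<open>U\<close> are represented as functions on the ambient type vanishing off \<open>U\<close>.\<close>

definition zero_sum_functions :: "'u set \<Rightarrow> ('u \<Rightarrow> complex) set" where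
  "zero_sum_functions U =
     {f. finite {X. f X \<noteq> 0} \<and> {X. f X \<noteq> 0} \<subseteq> U \<and> (\<Sum>X | f X \<noteq> 0. f X) = 0}"

definition kernel_form ::
  "('u \<Rightarrow> 'u \<Rightarrow> complex) \<Rightarrow> ('u \<Rightarrow> complex) \<Rightarrow> ('u \<Rightarrow> complex) \<Rightarrow> complex" where
  "kernel_form c f g = (\<Sum>X | f X \<noteq> 0. \<Sum>Y | g Y \<noteq> 0. c X Y * cnj (f X) * g Y)"

definition kernel_seminorm :: "('u \<Rightarrow> 'u \<Rightarrow> complex) \<Rightarrow> ('u \<Rightarrow> complex) \<Rightarrow> real" where
  "kernel_seminorm c f = sqrt (Re (kernel_form c f f))"

text \<open>The quotient by null vectors and the completion are carried out together: the points of
  the Hilbert space are the Cauchy sequences for the seminorm, two of them being identified if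
  their difference tends to \<open>0\<close> in seminorm.\<close>

definition kernel_cauchy ::
  "'u set \<Rightarrow> ('u \<Rightarrow> 'u \<Rightarrow> complex) \<Rightarrow> (nat \<Rightarrow> 'u \<Rightarrow> complex) set" where
  "kernel_cauchy U c =
     {F. (\<forall>n. F n \<in> zero_sum_functions U) \<and>
         (\<forall>e>0. \<exists>N. \<forall>m\<ge>N. \<forall>n\<ge>N. kernel_seminorm c (F m - F n) < e)}"

definition kernel_space ::
  "'u set \<Rightarrow> ('u \<Rightarrow> 'u \<Rightarrow> complex) \<Rightarrow> (nat \<Rightarrow> 'u \<Rightarrow> complex) set set" where
  "kernel_space U c = kernel_cauchy U c //
     {(F, G). F \<in> kernel_cauchy U c \<and> G \<in> kernel_cauchy U c \<and>
              (\<lambda>n. kernel_seminorm c (F n - G n)) \<longlonglongrightarrow> 0}"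

definition kernel_inner ::
  "('u \<Rightarrow> 'u \<Rightarrow> complex) \<Rightarrow> (nat \<Rightarrow> 'u \<Rightarrow> complex) set \<Rightarrow> (nat \<Rightarrow> 'u \<Rightarrow> complex) set
     \<Rightarrow> complex" where
  "kernel_inner c P Q =
     (THE z. \<forall>F\<in>P. \<forall>G\<in>Q. (\<lambda>n. kernel_form c (F n) (G n)) \<longlonglongrightarrow> z)"

text \<open>An orthonormal basis is a maximal orthonormal set. The Hilbert space dimension is the
  cardinality of an orthonormal basis; since all of them are equinumerous, it is well defined up
  to equality of cardinals, written \<open>=o\<close>.\<close>

definition orthonormal_set :: "'k set \<Rightarrow> ('k \<Rightarrow> 'k \<Rightarrow> complex) \<Rightarrow> 'k set \<Rightarrow> bool" where
  "orthonormal_set K ip B \<longleftrightarrow>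
     B \<subseteq> K \<and> (\<forall>a\<in>B. \<forall>b\<in>B. ip a b = (if a = b then 1 else 0))"

definition orthonormal_basis :: "'k set \<Rightarrow> ('k \<Rightarrow> 'k \<Rightarrow> complex) \<Rightarrow> 'k set \<Rightarrow> bool" where
  "orthonormal_basis K ip B \<longleftrightarrow>
     orthonormal_set K ip B \<and> (\<forall>B'. orthonormal_set K ip B' \<and> B \<subseteq> B' \<longrightarrow> B' = B)"

definition hilbert_dim :: "'k set \<Rightarrow> ('k \<Rightarrow> 'k \<Rightarrow> complex) \<Rightarrow> 'k rel" where
  "hilbert_dim K ip = card_of (SOME B. orthonormal_basis K ip B)"

definition coupling_index ::
  "('h::complex_hilbert \<Rightarrow>\<^sub>L 'h) set \<Rightarrow> 'h \<Rightarrow> (real \<Rightarrow> ('h \<Rightarrow>\<^sub>L 'h) \<Rightarrow> ('h \<Rightarrow>\<^sub>L 'h))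
     \<Rightarrow> (nat \<Rightarrow> (real \<Rightarrow> ('h \<Rightarrow>\<^sub>L 'h)) \<Rightarrow> complex) set rel" where
  "coupling_index M \<Omega> \<alpha> =
     hilbert_dim (kernel_space (multi_units M \<Omega> \<alpha>) covariance) (kernel_inner covariance)"

definition powers_arveson_index ::
  "(real \<Rightarrow> ('h::complex_hilbert \<Rightarrow>\<^sub>L 'h) \<Rightarrow> ('h \<Rightarrow>\<^sub>L 'h))
     \<Rightarrow> (nat \<Rightarrow> (real \<Rightarrow> ('h \<Rightarrow>\<^sub>L 'h)) \<Rightarrow> complex) set rel" where
  "powers_arveson_index \<sigma> =
     hilbert_dim (kernel_space (units \<sigma>) covariance) (kernel_inner covariance)"

end

theory Submission
  imports Defs
begin

text \<open>The multi-units of \<open>\<alpha>\<close> are exactly the units of \<open>\<sigma>\<close>. The point is that an operator \<open>T\<close>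
  intertwining the identity with a normal endomorphism \<open>\<phi>\<close> of \<open>B(H)\<close> on the irreducible set
  \<open>M \<union> M'\<close> does so on all of \<open>B(H)\<close>. Fix a unit vector \<open>e\<close>. For every vector \<open>g\<close>
  the map \<open>V\<^sub>g h = \<phi>(|h\<rangle>\<langle>e|) g\<close> intertwines the identity with \<open>\<phi>\<close>, so
  \<open>V\<^sub>g\<^sup>* T\<close> commutes with \<open>M \<union> M'\<close> and is a scalar. Hence
  \<open>V\<^sub>g\<^sup>* (T x - \<phi>(x) T) = 0\<close> for all \<open>x\<close> and \<open>g\<close>, which means that
  every \<open>\<phi>(|h\<rangle>\<langle>h|)\<close> kills the range of \<open>T x - \<phi>(x) T\<close>. As finite-rank projections
  approximate \<open>1\<close> ultraweakly and \<open>\<phi>\<close> is normal and unital, this range is zero.\<close>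

section \<open>Inner product and adjoints\<close>

lemma cinner_add_left: "cinner (x + y) z = cinner x z + cinner (y::'h::complex_hilbert) z"
  by (metis cinner_commute cinner_add_right complex_cnj_add)

lemma cinner_scaleC_left: "cinner (c *\<^sub>C x) y = cnj c * cinner x (y::'h::complex_hilbert)"
  by (metis cinner_commute cinner_scaleC_right complex_cnj_mult)

lemma cinner_scaleR_right: "cinner x (r *\<^sub>R y) = of_real r * cinner x (y::'h::complex_hilbert)"
  by (metis cinner_scaleC_right scaleC_of_real)

lemma cinner_zero_right [simp]: "cinner x (0::'h::complex_hilbert) = 0"
  by (metis add_cancel_right_right cinner_add_right)

lemma cinner_zero_left [simp]: "cinner 0 (x::'h::complex_hilbert) = 0"
  by (metis cinner_commute cinner_zero_right complex_cnj_zero)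

lemma cinner_minus_right: "cinner x (- y) = - cinner x (y::'h::complex_hilbert)"
  by (metis cinner_scaleR_right mult_minus1 of_real_1 of_real_minus scaleR_minus1_left)

lemma cinner_diff_right: "cinner x (y - z) = cinner x y - cinner x (z::'h::complex_hilbert)"
  using cinner_add_right[of x y "- z"] by (simp add: cinner_minus_right)

lemma cinner_eqI:
  assumes "\<And>z. cinner z x = cinner z y"
  shows "x = (y::'h::complex_hilbert)"
proof -
  have "cinner (x - y) (x - y) = 0"
    using assms by (simp add: cinner_diff_right)
  then show ?thesis
    by (simp add: cinner_self)
qed

lemma cinner_eqI_left:
  assumes "\<And>z. cinner x z = cinner y z"
  shows "x = (y::'h::complex_hilbert)"
  by (rule cinner_eqI) (metis assms cinner_commute)

section \<open>Norm expansions, the Cauchy-Schwarz inequality and Riesz representation\<close>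

lemma norm_add_squared:
  "(norm (x + y))\<^sup>2 = (norm x)\<^sup>2 + 2 * Re (cinner x y) + (norm (y::'h::complex_hilbert))\<^sup>2"
proof -
  have "complex_of_real ((norm (x + y))\<^sup>2) = cinner x x + (cinner x y + cnj (cinner x y)) + cinner y y"
    unfolding cinner_self[symmetric]
    by (simp add: cinner_add_left cinner_add_right) (metis cinner_commute)
  then have "Re (complex_of_real ((norm (x + y))\<^sup>2)) = Re (cinner x x + (cinner x y + cnj (cinner x y)) + cinner y y)"
    by simp
  then show ?thesis
    by (simp add: cinner_self del: of_real_power)
qed

lemma norm_diff_squared:
  "(norm (x - y))\<^sup>2 = (norm x)\<^sup>2 - 2 * Re (cinner x y) + (norm (y::'h::complex_hilbert))\<^sup>2"
  using norm_add_squared[of x "- y"] by (simp add: cinner_minus_right)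

lemma Cauchy_Schwarz_cinner: "cmod (cinner x y) \<le> norm x * norm (y::'h::complex_hilbert)"
proof (cases "x = 0")
  case False
  \<comment> \<open>With this \<open>c\<close>, the vector \<open>c *\<^sub>C x\<close> is the
    orthogonal projection of \<open>y\<close> onto the line through \<open>x\<close>; the inequality
    is the nonnegativity of the squared norm of the remainder.\<close>
  define c where "c = cinner x y / of_real ((norm x)\<^sup>2)"
  have n: "norm x \<noteq> 0" using False by simp
  have "0 \<le> (norm (y - c *\<^sub>C x))\<^sup>2" by simp
  also have "\<dots> = (norm y)\<^sup>2 - 2 * Re (c * cnj (cinner x y)) + (cmod c * norm x)\<^sup>2"
    by (simp add: norm_diff_squared cinner_scaleC_right norm_scaleC cinner_commute[of y x])
  also have "Re (c * cnj (cinner x y)) = (cmod (cinner x y))\<^sup>2 / (norm x)\<^sup>2"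
  proof -
    have "c * cnj (cinner x y) = of_real ((cmod (cinner x y))\<^sup>2 / (norm x)\<^sup>2)"
      by (simp add: c_def complex_norm_square del: of_real_power)
    then show ?thesis by (simp del: of_real_power of_real_divide)
  qed
  also have "(cmod c * norm x)\<^sup>2 = (cmod (cinner x y))\<^sup>2 / (norm x)\<^sup>2"
    using n unfolding c_def
    by (simp add: norm_divide norm_power power_mult_distrib power_divide)
       (simp add: field_simps flip: power_mult power_add)
  finally have "(cmod (cinner x y))\<^sup>2 \<le> (norm x * norm y)\<^sup>2"
    using n by (simp add: field_simps power_mult_distrib)
  then show ?thesis
    by (rule power2_le_imp_le) simp
qed simp

text \<open>The representing vector minimises \<open>\<parallel>x\<parallel>\<^sup>2 / 2 - Re (f x)\<close>; minimising sequences are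
  Cauchy by the parallelogram law.\<close>

lemma real_Riesz:
  fixes f :: "'h::complex_hilbert \<Rightarrow> real"
  assumes "bounded_linear f"
  obtains z where "\<And>x. Re (cinner z x) = f x"
proof -
  interpret f: bounded_linear f by fact
  obtain K where K: "\<And>x. \<bar>f x\<bar> \<le> norm x * K"
    using f.bounded by auto
  \<comment> \<open>Twice the functional named above, which has the same minimiser and avoids the
    fraction.\<close>
  define Q where "Q x = (norm x)\<^sup>2 - 2 * f x" for x
  define m where "m = Inf (range Q)"
  have bdd: "bdd_below (range Q)"
  proof (rule bdd_belowI2[where m = "- K\<^sup>2"])
    fix x :: 'h
    have "0 \<le> (norm x - K)\<^sup>2" by simp
    then show "- K\<^sup>2 \<le> Q x"
      using K[of x] unfolding Q_def power2_diff by auto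
  qed
  have m_le: "m \<le> Q x" for x
    unfolding m_def by (rule cInf_lower) (use bdd in auto)
  have "\<exists>x. Q x < m + inverse (Suc n)" for n :: nat
    using cInf_lessD[of "range Q" "m + inverse (Suc n)"] unfolding m_def by auto
  then obtain X where X: "\<And>n::nat. Q (X n) < m + inverse (Suc n)"
    by metis
  \<comment> \<open>The midpoint of \<open>x\<close> and \<open>y\<close> has value at least
    \<open>m\<close>, so the parallelogram law forces two near-minimisers to be close to each
    other.\<close>
  have par: "(norm (x - y))\<^sup>2 \<le> 2 * (Q x - m) + 2 * (Q y - m)" for x y
  proof -
    have "4 * m \<le> 4 * Q ((1/2) *\<^sub>R (x + y))"
      using m_le by simp
    also have "\<dots> = (norm (x + y))\<^sup>2 - 4 * f x - 4 * f y"
      by (simp add: Q_def f.scaleR f.add power_divide add_divide_distrib)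
    finally show ?thesis
      using norm_add_squared[of x y] norm_diff_squared[of x y] by (simp add: Q_def)
  qed
  have "Cauchy X"
  proof (rule metric_CauchyI)
    fix e :: real assume "0 < e"
    \<comment> \<open>In \<open>par\<close> each of the two points contributes less than twice
      \<open>inverse (Suc N)\<close>, which explains the factor 4.\<close>
    then obtain N :: nat where N: "inverse (Suc N) < e\<^sup>2 / 4"
      using reals_Archimedean[of "e\<^sup>2 / 4"] by auto
    have "dist (X i) (X j) < e" if "i \<ge> N" "j \<ge> N" for i j
    proof -
      have le: "inverse (real (Suc k)) \<le> inverse (Suc N)" if "k \<ge> N" for k
        using that by (simp add: divide_simps)
      have "(norm (X i - X j))\<^sup>2 < e\<^sup>2"
        using par[of "X i" "X j"] less_le_trans[OF X add_left_mono[OF le[OF that(1)]]]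
          less_le_trans[OF X add_left_mono[OF le[OF that(2)]]] N
        by (simp only: right_diff_distrib)
      then show ?thesis
        using \<open>0 < e\<close> by (simp add: dist_norm power2_less_imp_less)
    qed
    then show "\<exists>N. \<forall>i\<ge>N. \<forall>j\<ge>N. dist (X i) (X j) < e"
      by blast
  qed
  then obtain z where z: "X \<longlonglongrightarrow> z"
    by (meson Cauchy_convergent_iff convergent_def)
  have "(\<lambda>n. Q (X n)) \<longlonglongrightarrow> Q z"
    unfolding Q_def by (intro tendsto_intros f.tendsto z)
  moreover have "(\<lambda>n. m + inverse (real (Suc n))) \<longlonglongrightarrow> m + 0"
    by (intro tendsto_intros LIMSEQ_inverse_real_of_nat)
  ultimately have "Q z \<le> m"
    using X by (simp add: LIMSEQ_le less_imp_le)
  have "Re (cinner z x) = f x" for x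
  proof -
    \<comment> \<open>Up to the factor 2, \<open>d\<close> is the derivative at 0 of
      \<open>Q\<close> along the line from \<open>z\<close> in direction \<open>x\<close>, so it
      must vanish at a minimum.\<close>
    define d where "d = Re (cinner z x) - f x"
    have ineq: "0 \<le> r * (2 * d) + r\<^sup>2 * (norm x)\<^sup>2" for r
    proof -
      have "Q z \<le> Q (z + r *\<^sub>R x)"
        using \<open>Q z \<le> m\<close> m_le order_trans by blast
      then show ?thesis
        by (simp add: Q_def norm_add_squared f.add f.scaleR cinner_scaleR_right d_def
            power_mult_distrib algebra_simps)
    qed
    have "d = 0"
    proof (rule ccontr)
      assume "d \<noteq> 0"
      \<comment> \<open>Moving by \<open>- (d / s)\<close> makes the linear term twice as large as
        the bound on the quadratic one; the summand 1 keeps \<open>s\<close> positive when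
        \<open>x = 0\<close>.\<close>
      define s where "s = 1 + (norm x)\<^sup>2"
      have "s > 0" by (simp add: s_def add_pos_nonneg)
      have "0 \<le> - (d / s) * (2 * d) + (d / s)\<^sup>2 * (norm x)\<^sup>2"
        using ineq[of "- (d / s)"] by simp
      also have "\<dots> \<le> - (d / s) * (2 * d) + (d / s)\<^sup>2 * s"
        by (intro add_left_mono mult_left_mono) (simp_all add: s_def)
      also have "\<dots> = - (d\<^sup>2 / s)"
        using \<open>s > 0\<close> by (simp add: power2_eq_square field_simps)
      also have "\<dots> < 0"
        using \<open>s > 0\<close> \<open>d \<noteq> 0\<close> by simp
      finally show False by simp
    qed
    then show ?thesis by (simp add: d_def)
  qed
  then show ?thesis by (rule that)
qed

text \<open>A complex-linear functional is determined by its real part: evaluating at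
  \<open>\<i> *\<^sub>C x\<close> recovers the imaginary part. Hence the vector representing the
  real part represents \<open>f\<close> itself.\<close>

lemma complex_Riesz:
  fixes f :: "'h::complex_hilbert \<Rightarrow> complex"
  assumes "bounded_linear f" and lin: "\<And>c x. f (c *\<^sub>C x) = c * f x"
  obtains z where "\<And>x. cinner z x = f x"
proof -
  have "bounded_linear (\<lambda>x. Re (f x))"
    by (rule bounded_linear_compose[OF bounded_linear_Re assms(1)])
  then obtain z where z: "\<And>x. Re (cinner z x) = Re (f x)"
    using real_Riesz by blast
  have "cinner z x = f x" for x
  proof (rule complex_eqI)
    show "Im (cinner z x) = Im (f x)"
      using z[of "\<i> *\<^sub>C x"] by (simp add: cinner_scaleC_right lin)
  qed (rule z)
  then show ?thesis by (rule that)
qed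

section \<open>Complex-linear operators and their adjoints\<close>

lemma bounded_ops_scaleC: "A \<in> bounded_ops \<Longrightarrow> A (c *\<^sub>C v) = c *\<^sub>C A v"
  by (simp add: bounded_ops_def)

lemma bounded_ops_compose: "A \<in> bounded_ops \<Longrightarrow> B \<in> bounded_ops \<Longrightarrow> A o\<^sub>L B \<in> bounded_ops"
  by (simp add: bounded_ops_def)

lemma bounded_ops_add: "A \<in> bounded_ops \<Longrightarrow> B \<in> bounded_ops \<Longrightarrow> A + B \<in> bounded_ops"
  by (simp add: bounded_ops_def plus_blinfun.rep_eq scaleC_add_right)

lemma scaleC_zero_left [simp]: "0 *\<^sub>C (x::'h::complex_hilbert) = 0"
  using scaleC_of_real[of 0 x] by simp

lemma scaleC_one [simp]: "1 *\<^sub>C (x::'h::complex_hilbert) = x"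
  using scaleC_of_real[of 1 x] by simp

lemma scaleC_zero_right [simp]: "c *\<^sub>C (0::'h::complex_hilbert) = 0"
  by (metis add_cancel_right_right scaleC_add_right)

lemma zero_in_bounded_ops [simp]: "0 \<in> bounded_ops"
  by (simp add: bounded_ops_def)

lemma id_in_bounded_ops [simp]: "id_blinfun \<in> bounded_ops"
  by (simp add: bounded_ops_def)

lemma bounded_linear_cinner_right: "bounded_linear (cinner (x::'h::complex_hilbert))"
  by (rule bounded_linear_intro[where K = "norm x"])
     (simp_all add: cinner_add_right cinner_scaleR_right scaleR_conv_of_real mult.commute
       Cauchy_Schwarz_cinner[of x, simplified mult.commute[of "norm x"]])

text \<open>Riesz representation gives the value at each \<open>u\<close>; complex linearity of
  \<open>A\<close> is what makes the functional complex-linear. The norm bound comes from testing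
  the defining identity at \<open>v = b u\<close>.\<close>

lemma adjoint_exists:
  assumes A: "A \<in> bounded_ops"
  obtains B where "B \<in> bounded_ops" "\<And>u v. cinner (B u) v = cinner u (blinfun_apply A v)"
proof -
  have "\<exists>z. \<forall>v. cinner z v = cinner u (A v)" for u
  proof -
    have "bounded_linear (\<lambda>v. cinner u (A v))"
      by (rule bounded_linear_compose[OF bounded_linear_cinner_right blinfun.bounded_linear_right])
    then show ?thesis
      by (rule complex_Riesz) (auto simp: bounded_ops_scaleC[OF A] cinner_scaleC_right)
  qed
  then obtain b where b: "\<And>u v. cinner (b u) v = cinner u (A v)"
    by metis
  have bd: "norm (b u) \<le> norm u * norm A" for u
  proof (cases "b u = 0")
    case False
    have "(norm (b u))\<^sup>2 = cmod (cinner u (A (b u)))"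
      by (metis b cinner_self norm_of_real abs_power2)
    also have "\<dots> \<le> norm u * norm (A (b u))"
      by (rule Cauchy_Schwarz_cinner)
    also have "\<dots> \<le> norm u * (norm A * norm (b u))"
      by (intro mult_left_mono norm_blinfun) simp
    finally show ?thesis
      using False by (simp add: power2_eq_square)
  qed simp
  have scal: "b (c *\<^sub>C u) = c *\<^sub>C b u" for c u
    by (rule cinner_eqI_left) (simp add: b cinner_scaleC_left)
  have bl: "bounded_linear b"
  proof (rule bounded_linear_intro[where K = "norm A"])
    show "b (u + v) = b u + b v" for u v
      by (rule cinner_eqI_left) (simp add: b cinner_add_left)
    show "b (r *\<^sub>R u) = r *\<^sub>R b u" for r u
      using scal[of "of_real r"] by (simp add: scaleC_of_real)
  qed (rule bd)
  show ?thesis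
    by (rule that[of "Blinfun b"])
       (simp_all add: bounded_ops_def bounded_linear_Blinfun_apply[OF bl] scal b)
qed

text \<open>Definiteness of the inner product leaves at most one candidate for the definite
  description in \<open>adj_op\<close>, so exhibiting one identifies the adjoint.\<close>

lemma adj_op_eqI:
  assumes "\<And>u v. cinner (blinfun_apply B u) v = cinner u (blinfun_apply A v)"
  shows "adj_op A = B"
  unfolding adj_op_def
proof (rule the_equality)
  fix C :: "'a \<Rightarrow>\<^sub>L 'a"
  assume "\<forall>u v. cinner (C u) v = cinner u (A v)"
  then show "C = B"
    by (intro blinfun_eqI cinner_eqI_left) (simp add: assms)
qed (use assms in simp)

lemma
  assumes "A \<in> bounded_ops"
  shows adj_op_in_bounded_ops: "adj_op A \<in> bounded_ops"
    and cinner_adj_op_left: "cinner (adj_op A u) v = cinner u (blinfun_apply A v)"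
  using adjoint_exists[OF assms] adj_op_eqI by metis+

lemma cinner_adj_op_right:
  "A \<in> bounded_ops \<Longrightarrow> cinner u (adj_op A v) = cinner (blinfun_apply A u) v"
  by (metis cinner_adj_op_left cinner_commute)


section \<open>Rank-one operators and finite-rank projections\<close>

text \<open>The operator written |h><k| in Dirac notation.\<close>

definition rank_one :: "'h::complex_hilbert \<Rightarrow> 'h \<Rightarrow> 'h \<Rightarrow>\<^sub>L 'h" where
  "rank_one h k = Blinfun (\<lambda>v. cinner k v *\<^sub>C h)"

lemma rank_one_apply [simp]: "rank_one h k v = cinner k v *\<^sub>C h"
proof -
  have "bounded_linear (\<lambda>v. cinner k v *\<^sub>C h)"
  proof (rule bounded_linear_intro[where K = "norm k * norm h"])
    show "cinner k (r *\<^sub>R x) *\<^sub>C h = r *\<^sub>R cinner k x *\<^sub>C h" for r x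
      by (metis cinner_scaleR_right scaleC_of_real scaleC_scaleC)
    show "norm (cinner k x *\<^sub>C h) \<le> norm x * (norm k * norm h)" for x
      using mult_right_mono[OF Cauchy_Schwarz_cinner[of k x], of "norm h"]
      by (simp add: norm_scaleC mult_ac)
  qed (simp add: cinner_add_right scaleC_add_left)
  then show ?thesis
    by (simp add: rank_one_def bounded_linear_Blinfun_apply)
qed

lemma rank_one_in_bounded_ops [simp]: "rank_one h k \<in> bounded_ops"
  by (simp add: bounded_ops_def cinner_scaleC_right scaleC_scaleC)

lemma adj_op_rank_one: "adj_op (rank_one h k) = rank_one k h"
  by (rule adj_op_eqI)
     (simp add: cinner_scaleC_left cinner_scaleC_right mult.commute cinner_commute[of _ h])

lemma rank_one_compose: "rank_one a b o\<^sub>L rank_one c d = scalar_op (cinner b c) o\<^sub>L rank_one a d"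
  by (rule blinfun_eqI) (simp add: cinner_scaleC_right scaleC_scaleC mult.commute)

lemma compose_rank_one: "x \<in> bounded_ops \<Longrightarrow> x o\<^sub>L rank_one h k = rank_one (blinfun_apply x h) k"
  by (rule blinfun_eqI) (simp add: bounded_ops_scaleC)

text \<open>Adjoining one orthogonal unit vector at a time gives an induction principle under which
  an additive map is controlled by its values on the operators \<open>rank_one w w\<close>.\<close>

inductive finite_rank_projection :: "('h::complex_hilbert \<Rightarrow>\<^sub>L 'h) \<Rightarrow> bool" where
  zero: "finite_rank_projection 0"
| add: "finite_rank_projection F \<Longrightarrow> blinfun_apply F w = 0 \<Longrightarrow> norm w = 1 \<Longrightarrow>
    finite_rank_projection (F + rank_one w w)"

lemma finite_rank_projection_in_bounded_ops:
  "finite_rank_projection F \<Longrightarrow> F \<in> bounded_ops"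
  by (induction rule: finite_rank_projection.induct) (simp_all add: bounded_ops_add)

lemma finite_rank_projection_selfadjoint:
  assumes "finite_rank_projection F"
  shows "cinner (blinfun_apply F u) v = cinner u (blinfun_apply F v)"
  using assms
  by (induction rule: finite_rank_projection.induct)
     (simp_all add: plus_blinfun.rep_eq cinner_add_left cinner_add_right cinner_scaleC_left
       cinner_scaleC_right mult.commute cinner_commute[of u])

lemma finite_rank_projection_idem:
  assumes "finite_rank_projection F"
  shows "blinfun_apply F (blinfun_apply F v) = blinfun_apply F v"
  using assms
proof (induction rule: finite_rank_projection.induct)
  case (add F w)
  \<comment> \<open>Self-adjointness turns \<open>F w = 0\<close> into orthogonality of
    \<open>w\<close> to the range of \<open>F\<close>, so the cross terms of the square
    vanish.\<close>
  have "cinner w (F v) = 0"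
    using finite_rank_projection_selfadjoint[OF add.hyps(1), of w v] add.hyps(2) by simp
  moreover have "F (c *\<^sub>C w) = 0" for c
    using add.hyps by (simp add: bounded_ops_scaleC finite_rank_projection_in_bounded_ops)
  moreover have "cinner w w = 1"
    using add.hyps by (simp add: cinner_self)
  ultimately show ?case
    using add.IH
    by (simp add: plus_blinfun.rep_eq blinfun.add_right cinner_add_right cinner_scaleC_right)
qed simp

lemma finite_rank_projection_contraction:
  assumes "finite_rank_projection F"
  shows "norm (blinfun_apply F v) \<le> norm v"
proof (cases "F v = 0")
  case False
  have "complex_of_real ((norm (F v))\<^sup>2) = cinner v (F v)"
    using finite_rank_projection_selfadjoint[OF assms, of v "F v"]
    by (simp add: finite_rank_projection_idem[OF assms] cinner_self)
  then have "(norm (F v))\<^sup>2 \<le> norm v * norm (F v)"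
    using Cauchy_Schwarz_cinner[of v "F v"] by (metis norm_of_real abs_power2)
  then show ?thesis
    using False by (simp add: power2_eq_square)
qed simp

text \<open>Gram-Schmidt: the part of each new vector not yet covered is normalised and
  adjoined.\<close>

lemma finite_rank_projection_fixing:
  assumes "finite S"
  obtains F where "finite_rank_projection F" "\<And>v. v \<in> S \<Longrightarrow> blinfun_apply F v = v"
proof -
  have "\<exists>F. finite_rank_projection F \<and> (\<forall>v\<in>S. F v = v)"
    using assms
  proof (induction S rule: finite_induct)
    case empty
    then show ?case by (auto intro: finite_rank_projection.zero)
  next
    case (insert u S)
    then obtain F where F: "finite_rank_projection F" "\<forall>v\<in>S. F v = v"
      by blast
    define w where "w = u - F u"
    have Fw: "F w = 0"
      by (simp add: w_def blinfun.diff_right finite_rank_projection_idem[OF F(1)])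
    show ?case
    proof (cases "w = 0")
      case True
      then show ?thesis using F by (auto simp: w_def)
    next
      case False
      define e where "e = (1 / norm w) *\<^sub>R w"
      have e: "F e = 0" "norm e = 1"
        using False by (simp_all add: e_def blinfun.scaleR_right Fw)
      have orth: "cinner e (F v) = 0" for v
        using finite_rank_projection_selfadjoint[OF F(1), of e v] e(1) by simp
      have w: "w = of_real (norm w) *\<^sub>C e"
        using False by (simp add: e_def scaleC_of_real)
      \<comment> \<open>The new summand sends \<open>u\<close> to
        \<open>cinner e u *\<^sub>C e\<close>, so this coefficient shows that it supplies exactly
        the missing component \<open>w\<close>.\<close>
      have "cinner e w = of_real (norm w)"
        by (subst w) (simp add: cinner_scaleC_right cinner_self e)
      then have "cinner e u = of_real (norm w)"
        using orth[of u] by (simp add: w_def cinner_diff_right)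
      then have "(F + rank_one e e) u = u"
        using w by (simp add: plus_blinfun.rep_eq) (simp add: w_def)
      moreover have "(F + rank_one e e) v = v" if "v \<in> S" for v
        using that F(2) orth[of v] by (simp add: plus_blinfun.rep_eq)
      ultimately show ?thesis
        using finite_rank_projection.add[OF F(1) e] by auto
    qed
  qed
  then show ?thesis using that by blast
qed


section \<open>Ultraweak approximation of the identity\<close>

lemma predual_summable:
  fixes \<xi> \<eta> :: "nat \<Rightarrow> 'h::complex_hilbert"
  assumes "summable (\<lambda>n. (norm (\<xi> n))\<^sup>2)" "summable (\<lambda>n. (norm (\<eta> n))\<^sup>2)"
  shows "summable (\<lambda>n. norm (\<xi> n) * norm (\<eta> n))"
proof (rule summable_comparison_test')
  show "summable (\<lambda>n. (norm (\<xi> n))\<^sup>2 + (norm (\<eta> n))\<^sup>2)"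
    using assms by (rule summable_add)
  show "norm (norm (\<xi> n) * norm (\<eta> n)) \<le> (norm (\<xi> n))\<^sup>2 + (norm (\<eta> n))\<^sup>2" if "n \<ge> 0" for n
    using sum_squares_bound[of "norm (\<xi> n)" "norm (\<eta> n)"]
      mult_nonneg_nonneg[OF norm_ge_zero norm_ge_zero, of "\<xi> n" "\<eta> n"]
    unfolding real_norm_def abs_of_nonneg[OF mult_nonneg_nonneg[OF norm_ge_zero norm_ge_zero]]
    by linarith
qed

text \<open>Up to a small tail only finitely many of the vectors \<open>\<eta> n\<close> matter. A
  projection fixing those agrees with the identity on the head of the series, and as a contraction
  it is controlled on the tail independently of its rank.\<close>

lemma predual_approx:
  fixes \<rho> :: "('h::complex_hilbert \<Rightarrow>\<^sub>L 'h) \<Rightarrow> complex"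
  assumes "\<rho> \<in> predual bounded_ops" and "0 < e"
  obtains S :: "'h set" where "finite S"
    "\<And>F. finite_rank_projection F \<Longrightarrow> (\<And>v. v \<in> S \<Longrightarrow> blinfun_apply F v = v) \<Longrightarrow>
      dist (\<rho> F) (\<rho> id_blinfun) < e"
proof -
  obtain \<xi> \<eta> :: "nat \<Rightarrow> 'h" where
    sq: "summable (\<lambda>n. (norm (\<xi> n))\<^sup>2)" "summable (\<lambda>n. (norm (\<eta> n))\<^sup>2)" and
    \<rho>: "\<And>x. x \<in> bounded_ops \<Longrightarrow> \<rho> x = (\<Sum>n. cinner (\<xi> n) (blinfun_apply x (\<eta> n)))"
    using assms(1) unfolding predual_def by blast
  define a where "a n = norm (\<xi> n) * norm (\<eta> n)" for n
  have sa: "summable a"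
    unfolding a_def by (rule predual_summable[OF sq])
  \<comment> \<open>Half of \<open>e\<close>, because each tail term of the difference is bounded by
    \<open>2 * a n\<close>.\<close>
  have "\<exists>N. \<forall>n\<ge>N. norm (\<Sum>i. a (i + n)) < e / 2"
    by (rule suminf_exist_split[OF _ sa]) (use assms(2) in simp)
  then obtain N where N: "norm (\<Sum>i. a (i + N)) < e / 2"
    by blast
  show ?thesis
  proof (rule that)
    show "finite (\<eta> ` {..<N})" by simp
    fix F :: "'h \<Rightarrow>\<^sub>L 'h"
    assume F: "finite_rank_projection F" and fx: "\<And>v. v \<in> \<eta> ` {..<N} \<Longrightarrow> F v = v"
    have contr: "norm (cinner (\<xi> n) (F v)) \<le> norm (\<xi> n) * norm v" for n v
      using Cauchy_Schwarz_cinner[of "\<xi> n" "F v"]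
        mult_left_mono[OF finite_rank_projection_contraction[OF F, of v], of "norm (\<xi> n)"]
      by simp
    have s1: "summable (\<lambda>n. cinner (\<xi> n) (F (\<eta> n)))"
      by (rule summable_comparison_test'[OF sa]) (use contr in \<open>simp add: a_def\<close>)
    have s2: "summable (\<lambda>n. cinner (\<xi> n) (\<eta> n))"
      by (rule summable_comparison_test'[OF sa]) (use Cauchy_Schwarz_cinner in \<open>simp add: a_def\<close>)
    define d where "d n = cinner (\<xi> n) (F (\<eta> n)) - cinner (\<xi> n) (\<eta> n)" for n
    have sd: "summable d"
      unfolding d_def by (rule summable_diff[OF s1 s2])
    have d0: "d n = 0" if "n < N" for n
      using fx that by (simp add: d_def)
    have dle: "norm (d n) \<le> 2 * a n" for n
      unfolding d_def a_def
      using norm_triangle_ineq4[of "cinner (\<xi> n) (F (\<eta> n))" "cinner (\<xi> n) (\<eta> n)"]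
        contr[of n "\<eta> n"] Cauchy_Schwarz_cinner[of "\<xi> n" "\<eta> n"] by linarith
    have "\<rho> F - \<rho> id_blinfun = (\<Sum>n. d n)"
      unfolding d_def
      by (simp add: \<rho> finite_rank_projection_in_bounded_ops[OF F] suminf_diff[OF s1 s2])
    also have "\<dots> = (\<Sum>n. d (n + N))"
      using suminf_split_initial_segment[OF sd, of N] d0 by simp
    finally have "norm (\<rho> F - \<rho> id_blinfun) \<le> (\<Sum>n. 2 * a (n + N))"
      using summable_ignore_initial_segment[OF sa, of N] dle
      by (auto intro!: norm_suminf_le summable_mult)
    also have "\<dots> = 2 * (\<Sum>n. a (n + N))"
      by (rule suminf_mult[OF summable_ignore_initial_segment[OF sa]])
    also have "\<dots> < e"
      using N by simp
    finally show "dist (\<rho> F) (\<rho> id_blinfun) < e"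
      by (simp add: dist_norm)
  qed
qed

lemma ultraweak_nhd_of_id:
  fixes U :: "('h::complex_hilbert \<Rightarrow>\<^sub>L 'h) set"
  assumes "openin (ultraweak_topology bounded_ops) U"
    and "id_blinfun \<in> U"
  obtains F where "finite_rank_projection F" "F \<in> U"
proof -
  \<comment> \<open>Mere existence of a projection in \<open>U\<close> would not survive
    intersections. Requiring all projections that fix a finite set \<open>S\<close> does: for an
    intersection the two finite sets are united.\<close>
  let ?P = "\<lambda>U. id_blinfun \<in> U \<longrightarrow> (\<exists>S::'h set. finite S \<and>
    (\<forall>F. finite_rank_projection F \<longrightarrow> (\<forall>v\<in>S. blinfun_apply F v = v) \<longrightarrow> F \<in> U))"
  have "generate_topology_on
      {{x \<in> bounded_ops :: ('h \<Rightarrow>\<^sub>L 'h) set. \<rho> x \<in> W} |\<rho> W. \<rho> \<in> predual bounded_ops \<and> open W} U"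
    using assms(1) by (simp add: ultraweak_topology_def openin_topology_generated_by_iff)
  then have "?P U"
  proof (induction rule: generate_topology_on.induct)
    case (Int A B)
    show ?case
    proof
      assume "id_blinfun \<in> A \<inter> B"
      then obtain S S' where "finite S" "finite S'"
        "\<forall>F. finite_rank_projection F \<longrightarrow> (\<forall>v\<in>S. F v = v) \<longrightarrow> F \<in> A"
        "\<forall>F. finite_rank_projection F \<longrightarrow> (\<forall>v\<in>S'. F v = v) \<longrightarrow> F \<in> B"
        using Int.IH by auto
      then show "\<exists>S. finite S \<and> (\<forall>F. finite_rank_projection F \<longrightarrow> (\<forall>v\<in>S. F v = v) \<longrightarrow> F \<in> A \<inter> B)"
        by (intro exI[of _ "S \<union> S'"]) auto
    qed
  next
    case (UN K)
    then show ?case by (meson UnionE UnionI)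
  next
    case (Basis V)
    then obtain \<rho> W where V: "V = {x \<in> bounded_ops. \<rho> x \<in> W}" "\<rho> \<in> predual bounded_ops" "open W"
      by blast
    show ?case
    proof
      assume "id_blinfun \<in> V"
      then obtain e where "0 < e" and e: "ball (\<rho> id_blinfun) e \<subseteq> W"
        using V open_contains_ball by blast
      obtain S :: "'h set" where "finite S"
        "\<And>F. finite_rank_projection F \<Longrightarrow> (\<And>v. v \<in> S \<Longrightarrow> F v = v) \<Longrightarrow> dist (\<rho> F) (\<rho> id_blinfun) < e"
        using predual_approx[OF V(2) \<open>0 < e\<close>] by blast
      then show "\<exists>S. finite S \<and> (\<forall>F. finite_rank_projection F \<longrightarrow> (\<forall>v\<in>S. F v = v) \<longrightarrow> F \<in> V)"
        using e V(1) finite_rank_projection_in_bounded_ops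
        by (intro exI[of _ S]) (auto simp: dist_commute subset_iff)
    qed
  qed simp
  then show ?thesis
    using assms(2) finite_rank_projection_fixing that by metis
qed

section \<open>Vector functionals and nondegeneracy of normal endomorphisms\<close>

lemma vector_functional_in_predual: "(\<lambda>x. cinner u (blinfun_apply x v)) \<in> predual M"
proof -
  let ?\<xi> = "\<lambda>n::nat. if n = 0 then u else 0" and ?\<eta> = "\<lambda>n::nat. if n = 0 then v else 0"
  have "summable (\<lambda>n. (norm (?\<xi> n))\<^sup>2)" "summable (\<lambda>n. (norm (?\<eta> n))\<^sup>2)"
    by (rule summable_finite[of "{0}"]; simp)+
  moreover have "cinner u (blinfun_apply x v) = (\<Sum>n. cinner (?\<xi> n) (blinfun_apply x (?\<eta> n)))" for x
    by (subst suminf_finite[of "{0}"]) auto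
  ultimately show ?thesis
    unfolding predual_def by (intro CollectI exI[of _ ?\<xi>] exI[of _ ?\<eta>]) auto
qed

lemma openin_ultraweak_vector_functional:
  assumes "open W"
  shows "openin (ultraweak_topology M) {x \<in> M. cinner u (blinfun_apply x v) \<in> W}"
  unfolding ultraweak_topology_def openin_topology_generated_by_iff
  by (intro generate_topology_on.Basis CollectI
        exI[of _ "\<lambda>x. cinner u (blinfun_apply x v)"] exI[of _ W])
     (simp add: assms vector_functional_in_predual)

text \<open>By normality the preimage of an ultraweak neighbourhood of \<open>id_blinfun\<close>
  contains a finite-rank projection, whose image kills \<open>y\<close> by additivity.\<close>

lemma normal_endo_nondegenerate:
  fixes y :: "'h::complex_hilbert"
  assumes \<phi>: "normal_unital_star_endo bounded_ops \<phi>"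
    and "\<And>h. blinfun_apply (\<phi> (rank_one h h)) y = 0"
  shows "y = 0"
proof (rule ccontr)
  assume "y \<noteq> 0"
  let ?T = "ultraweak_topology (bounded_ops :: ('h \<Rightarrow>\<^sub>L 'h) set)"
  \<comment> \<open>An open set that contains the identity, since \<open>y\<close> is nonzero, but
    no operator killing \<open>y\<close>.\<close>
  define N where "N = {x \<in> bounded_ops. cinner y (blinfun_apply x y) \<in> - {0}}"
  have "openin ?T N"
    unfolding N_def by (rule openin_ultraweak_vector_functional) blast
  then have op: "openin ?T {x \<in> topspace ?T. \<phi> x \<in> N}"
    using \<phi> unfolding normal_unital_star_endo_def by (blast intro: openin_continuous_map_preimage)
  \<comment> \<open>Taking the whole plane as \<open>W\<close> shows that \<open>bounded_ops\<close>
    is itself open, hence lies in the space of the topology.\<close>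
  have "openin ?T {x \<in> bounded_ops. cinner y (blinfun_apply x y) \<in> UNIV}"
    by (rule openin_ultraweak_vector_functional) simp
  then have "bounded_ops \<subseteq> topspace ?T"
    using openin_subset by fastforce
  moreover have "id_blinfun \<in> N"
    using \<open>y \<noteq> 0\<close> by (simp add: N_def cinner_self)
  ultimately have "id_blinfun \<in> {x \<in> topspace ?T. \<phi> x \<in> N}"
    using \<phi> unfolding normal_unital_star_endo_def by auto
  with op obtain F where F: "finite_rank_projection F" "\<phi> F \<in> N"
    by (rule ultraweak_nhd_of_id) blast
  have add: "\<phi> (a + b) = \<phi> a + \<phi> b" if "a \<in> bounded_ops" "b \<in> bounded_ops" for a b
    using \<phi> that unfolding normal_unital_star_endo_def by blast
  have "\<phi> F y = 0"
    using F(1)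
  proof (induction rule: finite_rank_projection.induct)
    case zero
    \<comment> \<open>Additivity gives \<open>\<phi> 0 = \<phi> 0 + \<phi> 0\<close>, so
      \<open>\<phi> 0\<close> vanishes.\<close>
    show ?case using add[of 0 0] by simp
  next
    case (add F w)
    then show ?case
      using assms(2) \<open>\<And>a b. a \<in> bounded_ops \<Longrightarrow> b \<in> bounded_ops \<Longrightarrow> \<phi> (a + b) = \<phi> a + \<phi> b\<close>
      by (simp add: finite_rank_projection_in_bounded_ops plus_blinfun.rep_eq)
  qed
  then show False
    using F(2) by (simp add: N_def)
qed


section \<open>Intertwiners\<close>

lemma intertwiner_extends:
  fixes \<phi> :: "('h::complex_hilbert \<Rightarrow>\<^sub>L 'h) \<Rightarrow> ('h \<Rightarrow>\<^sub>L 'h)"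
  assumes \<phi>: "normal_unital_star_endo bounded_ops \<phi>"
    and S: "S \<subseteq> bounded_ops" "commutant S \<subseteq> range scalar_op"
    and T: "T \<in> bounded_ops" "\<And>x. x \<in> S \<Longrightarrow> T o\<^sub>L x = \<phi> x o\<^sub>L T"
    and x: "x \<in> bounded_ops"
  shows "T o\<^sub>L x = \<phi> x o\<^sub>L T"
proof (cases "\<exists>e::'h. e \<noteq> 0")
  case True
  then obtain e0 :: 'h where "e0 \<noteq> 0" by blast
  define e where "e = (1 / norm e0) *\<^sub>R e0"
  have e: "cinner e e = 1"
    using \<open>e0 \<noteq> 0\<close> by (simp add: e_def cinner_self)
  have \<phi>_in: "\<phi> a \<in> bounded_ops" if "a \<in> bounded_ops" for a
    using \<phi> that unfolding normal_unital_star_endo_def by blast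
  have \<phi>_add: "\<phi> (a + b) = \<phi> a + \<phi> b" if "a \<in> bounded_ops" "b \<in> bounded_ops" for a b
    using \<phi> that unfolding normal_unital_star_endo_def by blast
  have \<phi>_scal: "\<phi> (scalar_op c o\<^sub>L a) = scalar_op c o\<^sub>L \<phi> a" if "a \<in> bounded_ops" for a c
    using \<phi> that unfolding normal_unital_star_endo_def by blast
  have \<phi>_mult: "\<phi> (a o\<^sub>L b) = \<phi> a o\<^sub>L \<phi> b" if "a \<in> bounded_ops" "b \<in> bounded_ops" for a b
    using \<phi> that unfolding normal_unital_star_endo_def by blast
  have \<phi>_adj: "\<phi> (adj_op a) = adj_op (\<phi> a)" if "a \<in> bounded_ops" for a
    using \<phi> that unfolding normal_unital_star_endo_def by blast
  have \<phi>_cinner: "cinner (\<phi> a u) v = cinner u (\<phi> (adj_op a) v)" if "a \<in> bounded_ops" for a u v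
    using that by (simp add: \<phi>_adj \<phi>_in cinner_adj_op_right)
  have V: "\<exists>V\<in>bounded_ops. \<forall>h. blinfun_apply V h = \<phi> (rank_one h e) g" for g
  proof -
    let ?v = "\<lambda>h. blinfun_apply (\<phi> (rank_one h e)) g"
    have scal: "?v (c *\<^sub>C h) = c *\<^sub>C ?v h" for c h
    proof -
      have "rank_one (c *\<^sub>C h) e = scalar_op c o\<^sub>L rank_one h e"
        by (rule blinfun_eqI) (simp add: scaleC_scaleC mult.commute)
      then show ?thesis by (simp add: \<phi>_scal)
    qed
    \<comment> \<open>Since |e><h| |h><e| is the squared norm of \<open>h\<close> times |e><e|, the
      map \<open>?v\<close> scales all norms by one constant depending on \<open>g\<close>; this
      yields its boundedness.\<close>
    have "cinner (?v h) (?v h) = of_real ((norm h)\<^sup>2) * cinner g (\<phi> (rank_one e e) g)" for h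
    proof -
      have "cinner (?v h) (?v h) = cinner g ((\<phi> (rank_one e h) o\<^sub>L \<phi> (rank_one h e)) g)"
        by (simp add: \<phi>_cinner adj_op_rank_one)
      also have "\<phi> (rank_one e h) o\<^sub>L \<phi> (rank_one h e) = scalar_op (of_real ((norm h)\<^sup>2)) o\<^sub>L \<phi> (rank_one e e)"
        by (simp add: \<phi>_scal rank_one_compose cinner_self flip: \<phi>_mult)
      finally show ?thesis by (simp add: cinner_scaleC_right)
    qed
    then have "cmod (of_real ((norm (?v h))\<^sup>2))
        = cmod (of_real ((norm h)\<^sup>2) * cinner g (\<phi> (rank_one e e) g))" for h
      by (simp only: cinner_self)
    then have sq: "(norm (?v h))\<^sup>2 = (norm h)\<^sup>2 * cmod (cinner g (\<phi> (rank_one e e) g))" for h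
      by (simp only: norm_mult norm_of_real abs_power2)
    have nrm: "norm (?v h) = norm h * sqrt (cmod (cinner g (\<phi> (rank_one e e) g)))" for h
      using arg_cong[OF sq[of h], of sqrt] by (simp add: real_sqrt_mult)
    have bl: "bounded_linear ?v"
    proof (rule bounded_linear_intro)
      fix h k :: 'h
      have "rank_one (h + k) e = rank_one h e + rank_one k e"
        by (rule blinfun_eqI) (simp add: plus_blinfun.rep_eq scaleC_add_right)
      then show "?v (h + k) = ?v h + ?v k"
        by (simp add: \<phi>_add plus_blinfun.rep_eq)
    next
      show "?v (r *\<^sub>R h) = r *\<^sub>R ?v h" for r h
        using scal[of "of_real r"] by (simp add: scaleC_of_real)
      show "norm (?v h) \<le> norm h * sqrt (cmod (cinner g (\<phi> (rank_one e e) g)))" for h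
        by (simp add: nrm)
    qed
    show ?thesis
      by (rule bexI[of _ "Blinfun ?v"])
         (simp_all add: bounded_linear_Blinfun_apply[OF bl] bounded_ops_def scal)
  qed
  have orth: "cinner (\<phi> (rank_one h e) g) (((T o\<^sub>L x) - (\<phi> x o\<^sub>L T)) w) = 0" for g h w
  proof -
    obtain V where VB: "V \<in> bounded_ops" and V_app: "\<And>h. blinfun_apply V h = \<phi> (rank_one h e) g"
      using V by blast
    \<comment> \<open>Multiplicativity applied to a |h><e| = |a h><e|.\<close>
    have inter: "\<phi> a o\<^sub>L V = V o\<^sub>L a" if "a \<in> bounded_ops" for a
    proof (rule blinfun_eqI)
      fix h
      have "\<phi> a (V h) = (\<phi> a o\<^sub>L \<phi> (rank_one h e)) g"
        by (simp add: V_app)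
      also have "\<dots> = V (a h)"
        using that by (simp add: V_app compose_rank_one flip: \<phi>_mult)
      finally show "(\<phi> a o\<^sub>L V) h = (V o\<^sub>L a) h" by simp
    qed
    \<comment> \<open>The adjoint of \<open>inter\<close> at \<open>adj_op a\<close>, because
      \<open>\<phi>\<close> preserves adjoints.\<close>
    have adj_inter: "adj_op V o\<^sub>L \<phi> a = a o\<^sub>L adj_op V" if a: "a \<in> bounded_ops" for a
    proof (intro blinfun_eqI cinner_eqI)
      fix k z
      have "cinner z (adj_op V (\<phi> a k)) = cinner (\<phi> (adj_op a) (V z)) k"
        using a VB by (simp add: cinner_adj_op_right cinner_adj_op_left \<phi>_adj \<phi>_in)
      also have "\<phi> (adj_op a) (V z) = V (adj_op a z)"
        using inter[OF adj_op_in_bounded_ops[OF a]] by (metis blinfun_apply_blinfun_compose)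
      also have "cinner (V (adj_op a z)) k = cinner z (a (adj_op V k))"
        using a VB by (simp add: cinner_adj_op_left flip: cinner_adj_op_right)
      finally show "cinner z ((adj_op V o\<^sub>L \<phi> a) k) = cinner z ((a o\<^sub>L adj_op V) k)" by simp
    qed
    have "adj_op V o\<^sub>L T \<in> commutant S"
      unfolding commutant_def
    proof (intro CollectI conjI ballI)
      show "adj_op V o\<^sub>L T \<in> bounded_ops"
        using VB T by (simp add: bounded_ops_compose adj_op_in_bounded_ops)
      fix a assume "a \<in> S"
      then have "T (a u) = \<phi> a (T u)" "adj_op V (\<phi> a u) = a (adj_op V u)" for u
        using T(2)[of a] adj_inter[of a] S(1)
        by (auto simp: subset_iff simp flip: blinfun_apply_blinfun_compose)
      then show "(adj_op V o\<^sub>L T) o\<^sub>L a = a o\<^sub>L (adj_op V o\<^sub>L T)"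
        by (intro blinfun_eqI) simp
    qed
    then obtain c where c: "adj_op V o\<^sub>L T = scalar_op c"
      using S(2) by blast
    have c_app: "adj_op V (T u) = c *\<^sub>C u" for u
      by (metis c blinfun_apply_blinfun_compose scalar_op_apply)
    \<comment> \<open>The endomorphism can now be moved past \<open>adj_op V\<close> for every
      \<open>x\<close>, not just for those in \<open>S\<close>: both \<open>T (x w)\<close> and
      \<open>\<phi> x (T w)\<close> are sent to \<open>c *\<^sub>C x w\<close>.\<close>
    have "adj_op V (\<phi> x (T w)) = x (adj_op V (T w))"
      using adj_inter[OF x] by (metis blinfun_apply_blinfun_compose)
    then have "adj_op V (((T o\<^sub>L x) - (\<phi> x o\<^sub>L T)) w) = 0"
      by (simp add: minus_blinfun.rep_eq blinfun.diff_right c_app bounded_ops_scaleC[OF x])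
    then show ?thesis
      by (metis V_app VB cinner_adj_op_right cinner_zero_right)
  qed
  show ?thesis
  proof (rule blinfun_eqI)
    fix w
    define y where "y = ((T o\<^sub>L x) - (\<phi> x o\<^sub>L T)) w"
    have "y = 0"
    proof (rule normal_endo_nondegenerate[OF \<phi>])
      fix h
      \<comment> \<open>The vector \<open>g\<close> in \<open>orth\<close> is arbitrary, so the
        adjoint of \<open>\<phi> (rank_one h e)\<close> must kill \<open>y\<close>.\<close>
      have "\<phi> (rank_one e h) y = 0"
        by (rule cinner_eqI) (use orth[of h _ w] in \<open>simp add: y_def \<phi>_cinner adj_op_rank_one\<close>)
      \<comment> \<open>The normalisation of \<open>e\<close> is used here: the middle factor of the
        product is \<open>cinner e e = 1\<close>.\<close>
      moreover have "rank_one h h = rank_one h e o\<^sub>L rank_one e h"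
        by (rule blinfun_eqI) (simp add: rank_one_compose e)
      ultimately show "\<phi> (rank_one h h) y = 0"
        by (simp add: \<phi>_mult)
    qed
    then show "(T o\<^sub>L x) w = (\<phi> x o\<^sub>L T) w"
      by (simp add: y_def minus_blinfun.rep_eq)
  qed
\<comment> \<open>In the remaining case the Hilbert space is zero and all operators
  coincide.\<close>
qed (metis blinfun_eqI)

section \<open>Irreducibility of a factor with its commutant, and equality of the indices\<close>

text \<open>The commutant of a union is the intersection of the commutants; the double commutant
  property turns this into the centre, which is scalar.\<close>

lemma commutant_factor_union:
  assumes "vn_factor M"
  shows "commutant (M \<union> commutant M) = range scalar_op"
proof -
  have "commutant (M \<union> commutant M) = commutant M \<inter> commutant (commutant M)"
    by (auto simp: commutant_def)
  then show ?thesis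
    using assms by (auto simp: vn_factor_def von_neumann_algebra_def)
qed

theorem proposition3p7:
  fixes M :: "('h::complex_hilbert \<Rightarrow>\<^sub>L 'h) set"
    and \<Omega> :: 'h
    and \<alpha> \<sigma> :: "real \<Rightarrow> ('h \<Rightarrow>\<^sub>L 'h) \<Rightarrow> ('h \<Rightarrow>\<^sub>L 'h)"
  assumes "II1_factor M"
    and "standard_trace_vector M \<Omega>"
    and "E0_semigroup M \<alpha>"
    and "E0_semigroup bounded_ops \<sigma>"
    and "\<And>t x. 0 \<le> t \<Longrightarrow> x \<in> M \<Longrightarrow> \<sigma> t x = \<alpha> t x"
    and "\<And>t x'. 0 \<le> t \<Longrightarrow> x' \<in> commutant M \<Longrightarrow> \<sigma> t x' = complementary M \<Omega> \<alpha> t x'"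
  shows "coupling_index M \<Omega> \<alpha> =o powers_arveson_index \<sigma>"
proof -
  have fac: "vn_factor M"
    using assms(1) by (simp add: II1_factor_def)
  have sub: "M \<union> commutant M \<subseteq> bounded_ops"
    using fac by (auto simp: vn_factor_def von_neumann_algebra_def commutant_def)
  \<comment> \<open>Both indices come from one construction applied to these sets with the same
    covariance, so equal sets give the same chosen basis and the same cardinal.\<close>
  have "multi_units M \<Omega> \<alpha> = units \<sigma>"
  proof (intro equalityI subsetI)
    fix T assume T: "T \<in> multi_units M \<Omega> \<alpha>"
    have "T t o\<^sub>L x = \<sigma> t x o\<^sub>L T t" if "0 \<le> t" "x \<in> bounded_ops" for t x
    proof (rule intertwiner_extends[OF _ sub])
      show "normal_unital_star_endo bounded_ops (\<sigma> t)"
        using assms(4) that by (simp add: E0_semigroup_def)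
      show "commutant (M \<union> commutant M) \<subseteq> range scalar_op"
        by (simp add: commutant_factor_union[OF fac])
      show "T t \<in> bounded_ops"
        using T that by (simp add: multi_units_def operator_semigroup_def)
      show "T t o\<^sub>L a = \<sigma> t a o\<^sub>L T t" if "a \<in> M \<union> commutant M" for a
        using T that \<open>0 \<le> t\<close> assms(5,6) by (auto simp: multi_units_def)
    qed fact
    then show "T \<in> units \<sigma>"
      using T by (simp add: multi_units_def units_def)
  next
    \<comment> \<open>This inclusion is restriction from all bounded operators to \<open>M\<close>
      and its commutant.\<close>
    fix T assume "T \<in> units \<sigma>"
    then show "T \<in> multi_units M \<Omega> \<alpha>"
      using sub assms(5,6) by (simp add: multi_units_def units_def subset_iff)
  qed
  then show ?thesis
    by (simp add: coupling_index_def powers_arveson_index_def hilbert_dim_def card_of_refl)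
qed

end
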